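(* Let $C_*=1.2\cdot10^5$. For all integers $n\ge0$, all real $\alpha,\beta\ge-1/2$ and all $x\in(-1,1)$, $$\lambda_n^{(\alpha,\beta)}(x)\ \ge\ \frac{w_{\alpha,\beta}(x)\sqrt{1-x^2}}{3C_*^2\,(n+1)\,\Phi_n(\alpha+\beta+1)}.$$ In particular the Gauss–Jacobi quadrature weights for $w_{\alpha,\beta}$ obey the same lower bound at their nodes: the weight of the $(n+1)$-point Gauss–Jacobi rule at a node $x_k$ (a zero of $p_{n+1}^{(\alpha,\beta)}$) is at least the right-hand side evaluated at $x=x_k$.
   Context: For real $\alpha,\beta\ge-1/2$ put $w_{\alpha,\beta}(x)=(1-x)^\alpha(1+x)^\beta$, $-1<x<1$. For an integer $n\ge0$, $p_n^{(\alpha,\beta)}$ denotes the (Jacobi) polynomial of degree $n$ orthonormal in $L^2([-1,1],w_{\alpha,\beta}\,dx)$ (unique up to sign). The Christoffel function is $$\lambda_n^{(\alpha,\beta)}(x)=\min\Bigl\{\int_{-1}^1|Q(t)|^2w_{\alpha,\beta}(t)\,dt:\ Q \text{ a polynomial},\ \deg Q\le n,\ Q(x)=1\Bigr\}=\Bigl(\sum_{k=0}^n p_k^{(\alpha,\beta)}(x)^2\Bigr)^{-1}.$$ For $S\ge0$ and an integer $n\ge0$, $\Phi_n(S)=\max\{1,S^{1/3},S^{1/2}(n+1)^{-1/6}\}$. *)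

theory Defs
  imports "HOL-Analysis.Analysis" "HOL-Computational_Algebra.Polynomial"
begin

text \<open>
  At the endpoints \<open>x = 1\<close> and \<open>x = -1\<close> the value is \<open>0\<close>, because \<open>0 powr a = 0\<close>
  for every \<open>a\<close>; this does not affect the integrals below.
\<close>
definition jacobi_weight :: "real \<Rightarrow> real \<Rightarrow> real \<Rightarrow> real" where
  "jacobi_weight \<alpha> \<beta> x = (1 - x) powr \<alpha> * (1 + x) powr \<beta>"

text \<open>
  The orthonormal Jacobi polynomials are unique only up to sign, so the sequence is
  characterised by a predicate instead of being fixed by a sign convention.
\<close>
definition orthonormal_jacobi :: "real \<Rightarrow> real \<Rightarrow> (nat \<Rightarrow> real poly) \<Rightarrow> bool" where
  "orthonormal_jacobi \<alpha> \<beta> p \<longleftrightarrow>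
     (\<forall>k. degree (p k) = k) \<and>
     (\<forall>j k. integral {-1..1} (\<lambda>t. poly (p j) t * poly (p k) t * jacobi_weight \<alpha> \<beta> t)
            = (if j = k then 1 else 0))"

text \<open>
  The infimum is over a nonempty set (it contains the value at \<open>Q = 1\<close>) of nonnegative reals
  and is attained when \<open>\<alpha>, \<beta> > -1\<close>, so it is the minimum.
\<close>
definition christoffel :: "real \<Rightarrow> real \<Rightarrow> nat \<Rightarrow> real \<Rightarrow> real" where
  "christoffel \<alpha> \<beta> n x =
     (INF Q \<in> {Q :: real poly. degree Q \<le> n \<and> poly Q x = 1}.
        integral {-1..1} (\<lambda>t. \<bar>poly Q t\<bar>\<^sup>2 * jacobi_weight \<alpha> \<beta> t))"

definition Phi :: "nat \<Rightarrow> real \<Rightarrow> real" where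
  "Phi n S = Max {1, S powr (1/3), S powr (1/2) * real (n + 1) powr (-1/6)}"

text \<open>
  \<open>X\<close> and \<open>W\<close> are the nodes and weights of an \<open>m\<close>-point quadrature rule for the Jacobi weight
  that is exact in all degrees up to \<open>2 m - 1\<close>; the values of \<open>W\<close> outside \<open>X\<close> are irrelevant.
\<close>
definition gauss_jacobi_rule ::
    "real \<Rightarrow> real \<Rightarrow> nat \<Rightarrow> real set \<Rightarrow> (real \<Rightarrow> real) \<Rightarrow> bool" where
  "gauss_jacobi_rule \<alpha> \<beta> m X W \<longleftrightarrow>
     finite X \<and> card X = m \<and>
     (\<forall>Q :: real poly. degree Q < 2 * m \<longrightarrow>
        integral {-1..1} (\<lambda>t. poly Q t * jacobi_weight \<alpha> \<beta> t) = (\<Sum>x\<in>X. W x * poly Q x))"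

definition C_star :: real where
  "C_star = 1.2 * 10 ^ 5"

end

theory Submission
  imports Defs
begin

text \<open>
  Put \<open>S = \<alpha> + \<beta> + 1\<close> and \<open>\<rho> = w \<surd>(1 - x\<^sup>2)\<close>. The Jacobi operator is symmetric with eigenvalues \<open>k (k + S)\<close>,
  so \<open>\<integral> Q'\<^sup>2 (1 - t\<^sup>2) w \<le> n (n + S) \<integral> Q\<^sup>2 w\<close> whenever \<open>deg Q \<le> n\<close>. In the variable \<open>\<theta> = arccos x\<close>
  the weight \<open>\<rho>\<close> is unimodal, and every point lies in an interval of \<open>\<theta>\<close>-length about
  \<open>1 / \<surd>(S + 1)\<close> on which \<open>\<rho>\<close> does not fall below \<open>\<rho>(x) / e\<close>. A one-dimensional Sobolev argument on
  this interval gives \<open>Q(x)\<^sup>2 \<rho>(x) \<le> C (\<surd>(S + 1) + \<surd>(n (n + S) + 1)) \<integral> Q\<^sup>2 w\<close>, which is stronger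
  than the bound with \<open>(n + 1) \<Phi>\<^sub>n(S)\<close>, and \<open>C\<close> is far below \<open>3 C\<^sub>*\<^sup>2\<close>. A Gauss--Jacobi weight is
  the integral of the squared Lagrange polynomial of its node.
\<close>

section \<open>Integrability against the Jacobi weight\<close>

text \<open>The substitution \<open>x = 2 t - 1\<close> turns the weight into a constant multiple of
  the Beta integrand on \<open>{0..1}\<close>.\<close>

lemma integrable_jacobi_weight:
  assumes "\<alpha> > -1" "\<beta> > -1"
  shows "jacobi_weight \<alpha> \<beta> integrable_on {-1..1}"
proof -
  let ?f = "\<lambda>t::real. t powr \<beta> * (1 - t) powr \<alpha>"
  have "(?f has_integral Beta (\<beta> + 1) (\<alpha> + 1)) (cbox 0 1)"
    using has_integral_Beta_real[of "\<beta> + 1" "\<alpha> + 1"] assms by simp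
  from has_integral_affinity'[OF this, of "1/2" "1/2"]
  have "(\<lambda>x. ?f (x/2 + 1/2)) integrable_on {-1..1}"
    by (simp add: has_integral_integrable)
  then have "(\<lambda>x. 2 powr \<beta> * 2 powr \<alpha> * ?f (x/2 + 1/2)) integrable_on {-1..1}"
    by (rule integrable_on_mult_right)
  moreover have "2 powr \<beta> * 2 powr \<alpha> * ?f (x/2 + 1/2) = jacobi_weight \<alpha> \<beta> x"
    if "x \<in> {-1..1}" for x
  proof -
    have "jacobi_weight \<alpha> \<beta> x = (2 * (1 - (x/2 + 1/2))) powr \<alpha> * (2 * (x/2 + 1/2)) powr \<beta>"
      by (simp add: jacobi_weight_def algebra_simps)
    also have "\<dots> = (2 powr \<alpha> * (1 - (x/2 + 1/2)) powr \<alpha>) * (2 powr \<beta> * (x/2 + 1/2) powr \<beta>)"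
      by (simp only: powr_mult)
    finally show ?thesis by simp
  qed
  ultimately show ?thesis
    by (rule integrable_eq)
qed

lemma jacobi_weight_nonneg: "jacobi_weight \<alpha> \<beta> x \<ge> 0"
  by (simp add: jacobi_weight_def)

lemma jacobi_weight_pos: "-1 < x \<Longrightarrow> x < 1 \<Longrightarrow> jacobi_weight \<alpha> \<beta> x > 0"
  by (simp add: jacobi_weight_def)

text \<open>The weight may be unbounded at the endpoints, so the integrand need not be continuous
  there. It is nonnegative, hence absolutely integrable, and a bounded measurable factor preserves
  this.\<close>

lemma integrable_continuous_jacobi_weight:
  assumes "\<alpha> > -1" "\<beta> > -1" and f: "continuous_on {-1..1} f"
  shows "(\<lambda>t. f t * jacobi_weight \<alpha> \<beta> t) integrable_on {-1..1}"
proof -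
  have "jacobi_weight \<alpha> \<beta> absolutely_integrable_on {-1..1}"
    using integrable_jacobi_weight[OF assms(1,2)]
    by (rule nonnegative_absolutely_integrable_1) (simp add: jacobi_weight_nonneg)
  moreover have "bounded (f ` {-1..1})"
    using compact_continuous_image[OF f] by (simp add: compact_imp_bounded)
  moreover have "f \<in> borel_measurable (lebesgue_on {-1..1})"
    using f by (intro continuous_imp_measurable_on_sets_lebesgue) auto
  ultimately have "(\<lambda>t. f t * jacobi_weight \<alpha> \<beta> t) absolutely_integrable_on {-1..1}"
    by (intro absolutely_integrable_bounded_measurable_product_real) auto
  then show ?thesis
    by (rule set_lebesgue_integral_eq_integral(1))
qed

section \<open>The Jacobi operator and the weighted inner product\<close>

text \<open>This is the negated Jacobi differential operator; with this sign its quadratic form is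
  nonnegative. As an operation on \<open>poly\<close> it gives direct access to coefficients and
  degrees.\<close>

definition jacobi_op :: "real \<Rightarrow> real \<Rightarrow> real poly \<Rightarrow> real poly" where
  "jacobi_op \<alpha> \<beta> p =
     [:-1, 0, 1:] * pderiv (pderiv p) + [:\<alpha> - \<beta>, \<alpha> + \<beta> + 2:] * pderiv p"

text \<open>In the monomial basis the operator is triangular with the eigenvalues on the diagonal;
  this bounds the degree and governs the leading coefficient.\<close>

lemma coeff_jacobi_op:
  "coeff (jacobi_op \<alpha> \<beta> p) n =
     real n * (real n + \<alpha> + \<beta> + 1) * coeff p n
     + (\<alpha> - \<beta>) * real (n + 1) * coeff p (n + 1)
     - real (n + 1) * real (n + 2) * coeff p (n + 2)"
proof -
  \<comment> \<open>The factor \<open>[:-1, 0, 1:]\<close> shifts coefficients by two places, hence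
    two small cases.\<close>
  consider "n = 0" | "n = 1" | m where "n = Suc (Suc m)"
    by (metis One_nat_def not0_implies_Suc)
  then show ?thesis
    by cases (auto simp: jacobi_op_def coeff_pderiv algebra_simps)
qed

lemma degree_jacobi_op: "degree (jacobi_op \<alpha> \<beta> p) \<le> degree p"
  by (rule degree_le) (auto simp: coeff_jacobi_op coeff_eq_0)

lemma jacobi_op_add_smult:
  "jacobi_op \<alpha> \<beta> (p + smult c q) = jacobi_op \<alpha> \<beta> p + smult c (jacobi_op \<alpha> \<beta> q)"
  by (rule poly_eqI) (simp add: coeff_jacobi_op algebra_simps)

definition jacobi_inner :: "real \<Rightarrow> real \<Rightarrow> real poly \<Rightarrow> real poly \<Rightarrow> real" where
  "jacobi_inner \<alpha> \<beta> p q = integral {-1..1} (\<lambda>t. poly p t * poly q t * jacobi_weight \<alpha> \<beta> t)"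

lemma jacobi_inner_commute: "jacobi_inner \<alpha> \<beta> p q = jacobi_inner \<alpha> \<beta> q p"
  by (simp add: jacobi_inner_def mult_ac)

lemma jacobi_inner_smult_left: "jacobi_inner \<alpha> \<beta> (smult c p) q = c * jacobi_inner \<alpha> \<beta> p q"
  by (simp add: jacobi_inner_def mult.assoc)

lemma jacobi_inner_0_left: "jacobi_inner \<alpha> \<beta> 0 q = 0"
  by (simp add: jacobi_inner_def)

context
  fixes \<alpha> \<beta> :: real
  assumes \<alpha>: "\<alpha> > -1" and \<beta>: "\<beta> > -1"
begin

lemma jacobi_inner_integrable:
  "(\<lambda>t. poly p t * poly q t * jacobi_weight \<alpha> \<beta> t) integrable_on {-1..1}"
  by (intro integrable_continuous_jacobi_weight \<alpha> \<beta> continuous_intros)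

lemma jacobi_inner_add_left:
  "jacobi_inner \<alpha> \<beta> (p + q) r = jacobi_inner \<alpha> \<beta> p r + jacobi_inner \<alpha> \<beta> q r"
  unfolding jacobi_inner_def
  by (subst integral_add[symmetric])
     (auto intro!: jacobi_inner_integrable simp: distrib_right)

lemma jacobi_inner_add_right:
  "jacobi_inner \<alpha> \<beta> r (p + q) = jacobi_inner \<alpha> \<beta> r p + jacobi_inner \<alpha> \<beta> r q"
  using jacobi_inner_add_left by (simp add: jacobi_inner_commute[of _ _ r])

text \<open>On \<open>{-1/2..1/2}\<close> the integrand is continuous, so a zero integral there
  would give \<open>p\<close> infinitely many roots.\<close>

lemma jacobi_inner_pos:
  assumes "p \<noteq> 0"
  shows "jacobi_inner \<alpha> \<beta> p p > 0"
proof -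
  let ?f = "\<lambda>t. poly p t * poly p t * jacobi_weight \<alpha> \<beta> t"
  have nonneg: "?f t \<ge> 0" for t
    by (simp add: jacobi_weight_nonneg)
  have cont: "continuous_on {-1/2..1/2} ?f"
    unfolding jacobi_weight_def by (intro continuous_intros) auto
  have int: "?f integrable_on {-1/2..1/2}"
    using cont by (rule integrable_continuous_real)
  have "integral {-1/2..1/2} ?f \<noteq> 0"
  proof
    assume "integral {-1/2..1/2} ?f = 0"
    then have 0: "(?f has_integral 0) (cbox (-1/2) (1/2))"
      using integrable_integral[OF int] by simp
    have "poly p x = 0" if "x \<in> {-1/2..1/2}" for x
    proof -
      have "?f x = 0"
        using that cont nonneg by (intro has_integral_0_cbox_imp_0[OF _ _ 0]) (auto simp: box_real)
      then show ?thesis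
        using jacobi_weight_pos[of x \<alpha> \<beta>] that by auto
    qed
    then have "{-1/2..1/2} \<subseteq> {x. poly p x = 0}"
      by blast
    then have "finite {-1/2..1/2::real}"
      using poly_roots_finite[OF assms] finite_subset by blast
    then show False
      by (simp add: infinite_Icc)
  qed
  moreover have "integral {-1/2..1/2} ?f \<ge> 0"
    by (intro integral_nonneg int nonneg)
  moreover have "integral {-1/2..1/2} ?f \<le> integral {-1..1} ?f"
    by (intro integral_subset_le int jacobi_inner_integrable) (use nonneg in auto)
  ultimately show ?thesis
    unfolding jacobi_inner_def by linarith
qed

text \<open>
  The Jacobi operator is \<open>L p = - ((1 - x\<^sup>2) w p')' / w\<close>; the boundary term
  \<open>(1 - x\<^sup>2) w p' q\<close> vanishes at both endpoints.
\<close>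
lemma jacobi_op_by_parts:
  "jacobi_inner \<alpha> \<beta> (jacobi_op \<alpha> \<beta> p) q
     = jacobi_inner \<alpha> \<beta> (pderiv p * pderiv q) [:1, 0, -1:]"
proof -
  let ?w = "jacobi_weight \<alpha> \<beta>"
  \<comment> \<open>\<open>F\<close> is \<open>(1 - t\<^sup>2) w p' q\<close>. The exponents
    \<open>\<alpha> + 1\<close> and \<open>\<beta> + 1\<close> are positive, so it is continuous up
    to the endpoints and vanishes there.\<close>
  define F where "F t = (1 - t) powr (\<alpha> + 1) * (1 + t) powr (\<beta> + 1) * poly (pderiv p * q) t" for t
  let ?g = "\<lambda>t. poly (pderiv p * pderiv q) t * poly [:1, 0, -1:] t * ?w t
                 - poly (jacobi_op \<alpha> \<beta> p) t * poly q t * ?w t"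
  have "(?g has_integral (F 1 - F (-1))) {-1..1}"
  proof (rule fundamental_theorem_of_calculus_interior)
    show "continuous_on {-1..1} F"
      unfolding F_def using \<alpha> \<beta>
      by (intro continuous_intros continuous_on_powr') auto
    show "(F has_vector_derivative ?g t) (at t)" if "t \<in> {-1<..<1}" for t
    proof -
      have *: "(1 - t) powr (\<alpha> + 1) = (1 - t) * (1 - t) powr \<alpha>"
        "(1 + t) powr (\<beta> + 1) = (1 + t) * (1 + t) powr \<beta>"
        using that by (simp_all add: powr_add)
      have "(F has_real_derivative
         (- (\<alpha> + 1) * (1 - t) powr \<alpha>) * (1 + t) powr (\<beta> + 1) * poly (pderiv p * q) t
         + (1 - t) powr (\<alpha> + 1) * ((\<beta> + 1) * (1 + t) powr \<beta>) * poly (pderiv p * q) t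
         + (1 - t) powr (\<alpha> + 1) * (1 + t) powr (\<beta> + 1) * poly (pderiv (pderiv p * q)) t) (at t)"
        unfolding F_def
        by (rule derivative_eq_intros refl | use that in force)+
           (use that in \<open>simp add: algebra_simps\<close>)
      also have "(- (\<alpha> + 1) * (1 - t) powr \<alpha>) * (1 + t) powr (\<beta> + 1) * poly (pderiv p * q) t
         + (1 - t) powr (\<alpha> + 1) * ((\<beta> + 1) * (1 + t) powr \<beta>) * poly (pderiv p * q) t
         + (1 - t) powr (\<alpha> + 1) * (1 + t) powr (\<beta> + 1) * poly (pderiv (pderiv p * q)) t = ?g t"
        unfolding * jacobi_weight_def jacobi_op_def pderiv_mult
        by (simp add: algebra_simps)
      finally show ?thesis
        by (simp add: has_real_derivative_iff_has_vector_derivative)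
    qed
  qed auto
  moreover have "F 1 = 0" "F (-1) = 0"
    by (simp_all add: F_def)
  ultimately have "(?g has_integral 0) {-1..1}"
    by (simp only: diff_self)
  then have "integral {-1..1} ?g = 0"
    by (rule integral_unique)
  then show ?thesis
    unfolding jacobi_inner_def
    by (simp only: integral_diff[OF jacobi_inner_integrable jacobi_inner_integrable] right_minus_eq)
qed

lemma jacobi_op_symmetric:
  "jacobi_inner \<alpha> \<beta> (jacobi_op \<alpha> \<beta> p) q = jacobi_inner \<alpha> \<beta> p (jacobi_op \<alpha> \<beta> q)"
  unfolding jacobi_inner_commute[of \<alpha> \<beta> p] jacobi_op_by_parts by (simp only: mult.commute)

section \<open>Orthogonal polynomials and the energy inequality\<close>

text \<open>Gram-Schmidt: orthogonality is first arranged against the polynomials \<open>P k\<close>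
  of lower degree, and then extends to all polynomials of lower degree.\<close>

lemma orthogonal_poly_exists:
  "\<exists>p. degree p = n \<and> coeff p n = 1 \<and> (\<forall>q. degree q < n \<longrightarrow> jacobi_inner \<alpha> \<beta> p q = 0)"
proof (induction n rule: less_induct)
  case (less n)
  then obtain P where P: "\<And>k. k < n \<Longrightarrow> degree (P k) = k \<and> coeff (P k) k = 1 \<and>
      (\<forall>q. degree q < k \<longrightarrow> jacobi_inner \<alpha> \<beta> (P k) q = 0)"
    by metis
  \<comment> \<open>Starting from the monomial, the components along the \<open>P k\<close> are
    removed one at a time; each correction has degree below \<open>n\<close>, so the leading
    coefficient stays 1.\<close>
  have "\<exists>p. degree p = n \<and> coeff p n = 1 \<and> (\<forall>k<m. jacobi_inner \<alpha> \<beta> p (P k) = 0)" if "m \<le> n" for m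
    using that
  proof (induction m)
    case 0
    show ?case
      by (intro exI[of _ "monom 1 n"]) (simp add: degree_monom_eq)
  next
    case (Suc m)
    then obtain p where p: "degree p = n" "coeff p n = 1"
      "\<And>k. k < m \<Longrightarrow> jacobi_inner \<alpha> \<beta> p (P k) = 0"
      by auto
    have m: "m < n" using Suc by simp
    have "P m \<noteq> 0" using P[OF m] by auto
    then have pos: "jacobi_inner \<alpha> \<beta> (P m) (P m) > 0"
      by (rule jacobi_inner_pos)
    define c where "c = - jacobi_inner \<alpha> \<beta> p (P m) / jacobi_inner \<alpha> \<beta> (P m) (P m)"
    define r where "r = p + smult c (P m)"
    have "degree (smult c (P m)) < n"
      using P[OF m] m by (metis degree_smult_le le_less_trans)
    then have "degree r = n" "coeff r n = 1"
      using p coeff_eq_0[of "smult c (P m)" n] by (auto simp: r_def degree_add_eq_left simp del: degree_smult_eq)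
    moreover have "jacobi_inner \<alpha> \<beta> r (P k) = 0" if "k < Suc m" for k
    proof (cases "k = m")
      case True
      then show ?thesis
        using pos unfolding r_def jacobi_inner_add_left jacobi_inner_smult_left
        by (simp add: c_def)
    next
      case False
      then have "k < m" using that by simp
      then show ?thesis
        using p(3) P[of m] P[of k] m
        by (simp add: r_def jacobi_inner_add_left jacobi_inner_smult_left)
    qed
    ultimately show ?case by blast
  qed
  then obtain p where p: "degree p = n" "coeff p n = 1"
    "\<And>k. k < n \<Longrightarrow> jacobi_inner \<alpha> \<beta> p (P k) = 0"
    by blast
  have "jacobi_inner \<alpha> \<beta> p q = 0" if "degree q < n" for q
    using that
  proof (induction "degree q" arbitrary: q rule: less_induct)
    case (less q)
    let ?k = "degree q"
    have Pk: "degree (P ?k) = ?k" "coeff (P ?k) ?k = 1"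
      using P less.prems by auto
    define r where "r = q - smult (lead_coeff q) (P ?k)"
    \<comment> \<open>The alternative \<open>r = 0\<close> covers constant \<open>q\<close>, whose
      degree 0 cannot drop.\<close>
    have "r = 0 \<or> degree r < ?k"
    proof -
      have "degree r \<le> ?k" unfolding r_def
        using Pk by (intro degree_diff_le) auto
      moreover have "coeff r ?k = 0" using Pk by (simp add: r_def)
      ultimately show ?thesis
        by (metis leading_coeff_0_iff le_neq_implies_less)
    qed
    then have "jacobi_inner \<alpha> \<beta> p r = 0"
      using less by (auto simp: jacobi_inner_commute[of _ _ p] jacobi_inner_0_left)
    moreover have "q = r + smult (lead_coeff q) (P ?k)"
      by (simp add: r_def)
    moreover have "jacobi_inner \<alpha> \<beta> p (smult (lead_coeff q) (P ?k)) = 0"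
      using p(3)[OF less.prems] jacobi_inner_smult_left[of \<alpha> \<beta> _ _ p]
      by (simp add: jacobi_inner_commute[of _ _ p])
    ultimately show ?case
      using jacobi_inner_add_right[of p r "smult (lead_coeff q) (P ?k)"] by simp
  qed
  then show ?case
    using p by blast
qed

text \<open>Induction on the degree bound: \<open>p\<close> is split into \<open>q\<close> of degree
  at most \<open>n\<close> and a multiple of the monic orthogonal polynomial \<open>e\<close> of
  degree \<open>n + 1\<close>. The operator sends \<open>e\<close> to its eigenvalue multiple plus a
  remainder orthogonal to \<open>e\<close>, and the cross terms vanish, so both quadratic forms
  split along this sum.\<close>

lemma jacobi_op_le_eigenvalue:
  assumes "\<alpha> + \<beta> + 1 \<ge> 0" "degree p \<le> n"
  shows "jacobi_inner \<alpha> \<beta> (jacobi_op \<alpha> \<beta> p) p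
           \<le> real n * (real n + \<alpha> + \<beta> + 1) * jacobi_inner \<alpha> \<beta> p p"
  using assms(2)
proof (induction n arbitrary: p)
  case 0
  then have "pderiv p = 0"
    by (simp add: pderiv_eq_0_iff)
  then have "jacobi_op \<alpha> \<beta> p = 0"
    by (simp add: jacobi_op_def)
  then show ?case
    by (simp add: jacobi_inner_0_left)
next
  case (Suc n)
  let ?l = "\<lambda>n. real n * (real n + \<alpha> + \<beta> + 1)"
  let ?N = "Suc n"
  obtain e where e: "degree e = ?N" "coeff e ?N = 1"
    and orth: "\<And>q. degree q < ?N \<Longrightarrow> jacobi_inner \<alpha> \<beta> e q = 0"
    using orthogonal_poly_exists[of ?N] by blast
  have orth': "jacobi_inner \<alpha> \<beta> q e = 0" if "degree q < ?N" for q
    using orth[OF that] by (simp add: jacobi_inner_commute)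
  have le: "degree r \<le> n" if "degree r \<le> ?N" "coeff r ?N = 0" for r :: "real poly"
    using that by (metis le_SucE leading_coeff_0_iff degree_0 zero_le)
  define c where "c = coeff p ?N"
  define q where "q = p - smult c e"
  have p: "p = q + smult c e" by (simp add: q_def)
  have q: "degree q \<le> n"
    by (rule le) (use Suc.prems e in \<open>auto simp: q_def c_def intro!: degree_diff_le order_trans[OF degree_smult_le]\<close>)
  \<comment> \<open>By triangularity the coefficients of degree \<open>n + 1\<close> cancel in
    \<open>r\<close>.\<close>
  define r where "r = jacobi_op \<alpha> \<beta> e - smult (?l ?N) e"
  have r: "degree r \<le> n"
    by (rule le)
       (use degree_jacobi_op[of \<alpha> \<beta> e] e in
         \<open>auto simp: r_def coeff_jacobi_op coeff_eq_0 intro!: degree_diff_le order_trans[OF degree_smult_le]\<close>)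
  have Le: "jacobi_op \<alpha> \<beta> e = r + smult (?l ?N) e" by (simp add: r_def)
  have Lp: "jacobi_op \<alpha> \<beta> p = jacobi_op \<alpha> \<beta> q + smult c (jacobi_op \<alpha> \<beta> e)"
    unfolding p by (rule jacobi_op_add_smult)
  have Lq: "degree (jacobi_op \<alpha> \<beta> q) < ?N"
    using degree_jacobi_op[of \<alpha> \<beta> q] q by linarith
  have smult_right: "jacobi_inner \<alpha> \<beta> a (smult c b) = c * jacobi_inner \<alpha> \<beta> a b" for a b c
    by (metis jacobi_inner_commute jacobi_inner_smult_left)
  have Lee: "jacobi_inner \<alpha> \<beta> (jacobi_op \<alpha> \<beta> e) e = ?l ?N * jacobi_inner \<alpha> \<beta> e e"
    unfolding Le using r by (simp add: jacobi_inner_add_left jacobi_inner_smult_left orth')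
  \<comment> \<open>Symmetry moves the operator to \<open>q\<close>, whose image still has degree
    below that of \<open>e\<close>.\<close>
  have Leq: "jacobi_inner \<alpha> \<beta> (jacobi_op \<alpha> \<beta> e) q = 0"
    by (simp add: jacobi_op_symmetric orth Lq)
  have "jacobi_inner \<alpha> \<beta> (jacobi_op \<alpha> \<beta> p) p
      = jacobi_inner \<alpha> \<beta> (jacobi_op \<alpha> \<beta> q) q + c\<^sup>2 * (?l ?N * jacobi_inner \<alpha> \<beta> e e)"
    unfolding Lp using Lee Leq orth'[OF Lq]
    unfolding p[THEN arg_cong, of "jacobi_inner \<alpha> \<beta> _"]
    by (simp add: jacobi_inner_add_left jacobi_inner_add_right
        jacobi_inner_smult_left smult_right power2_eq_square)
  also have "\<dots> \<le> ?l ?N * jacobi_inner \<alpha> \<beta> q q + c\<^sup>2 * (?l ?N * jacobi_inner \<alpha> \<beta> e e)"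
  proof -
    \<comment> \<open>Since \<open>\<alpha> + \<beta> + 1 \<ge> 0\<close>, the eigenvalues increase
      with the degree.\<close>
    have "?l n \<le> ?l ?N"
      using assms(1) by (intro mult_mono) auto
    moreover have "jacobi_inner \<alpha> \<beta> q q \<ge> 0"
      by (cases "q = 0") (auto simp: jacobi_inner_0_left dest!: jacobi_inner_pos)
    ultimately show ?thesis
      using Suc.IH[OF q] by (meson add_right_mono mult_right_mono order_trans)
  qed
  also have "\<dots> = ?l ?N * jacobi_inner \<alpha> \<beta> p p"
    using q orth orth' unfolding p
    by (simp add: jacobi_inner_add_left jacobi_inner_add_right
        jacobi_inner_smult_left smult_right power2_eq_square algebra_simps)
  finally show ?case .
qed

text \<open>Integration by parts with \<open>q = p\<close> identifies the quadratic form of the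
  operator with the weighted energy of \<open>p'\<close>.\<close>

corollary jacobi_energy_bound:
  assumes "\<alpha> + \<beta> + 1 \<ge> 0" "degree p \<le> n"
  shows "integral {-1..1} (\<lambda>t. (poly (pderiv p) t)\<^sup>2 * (1 - t\<^sup>2) * jacobi_weight \<alpha> \<beta> t)
           \<le> real n * (real n + \<alpha> + \<beta> + 1)
             * integral {-1..1} (\<lambda>t. (poly p t)\<^sup>2 * jacobi_weight \<alpha> \<beta> t)"
  using jacobi_op_le_eigenvalue[OF assms] unfolding jacobi_op_by_parts
  by (simp add: jacobi_inner_def power2_eq_square)

end

section \<open>Slow decay of the weight in the angular variable\<close>

text \<open>The function is the logarithm of the weight with exponents \<open>a\<close>,
  \<open>b\<close> at \<open>cos t\<close>. The numerator of the derivative is monotone in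
  \<open>cos t\<close>, which gives unimodality for \<open>a, b \<ge> 0\<close>.\<close>

lemma log_jacobi_weight_deriv:
  fixes a b t :: real
  assumes "0 < t" "t < pi"
  shows "((\<lambda>t. a * ln (1 - cos t) + b * ln (1 + cos t)) has_real_derivative
           ((a + b) * cos t - (b - a)) / sin t) (at t)"
proof -
  have s: "sin t > 0" using assms by (rule sin_gt_zero)
  have c: "1 - cos t > 0" "1 + cos t > 0"
    using assms cos_monotone_0_pi[of 0 t] cos_monotone_0_pi[of t pi] by auto
  have "sin t * sin t = (1 - cos t) * (1 + cos t)"
    using sin_squared_eq[of t] by (simp add: power2_eq_square algebra_simps)
  then have eqs: "sin t / (1 - cos t) = (1 + cos t) / sin t" "sin t / (1 + cos t) = (1 - cos t) / sin t"
    using s c by (simp_all add: field_simps)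
  have "a * (sin t / (1 - cos t)) - b * (sin t / (1 + cos t))
      = (a * (1 + cos t) - b * (1 - cos t)) / sin t"
    unfolding eqs by (simp add: diff_divide_distrib right_diff_distrib)
  moreover have "a * (1 + cos t) - b * (1 - cos t) = (a + b) * cos t - (b - a)"
    by (simp add: algebra_simps)
  moreover have "((\<lambda>t. a * ln (1 - cos t) + b * ln (1 + cos t)) has_real_derivative
      a * (sin t / (1 - cos t)) - b * (sin t / (1 + cos t))) (at t)"
    using c by (auto intro!: derivative_eq_intros simp: mult_ac)
  ultimately show ?thesis by (simp only:)
qed

text \<open>
  The function is unimodal with its peak at \<open>p\<close>. Left of \<open>p + h\<close> the interval is taken to the
  right of \<open>\<theta>\<close>, where \<open>p \<le> \<pi> / 2\<close> keeps it away from \<open>\<pi>\<close>; otherwise it is taken to the left.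
\<close>
lemma log_jacobi_weight_interval_aux:
  fixes a b h \<theta> :: real
  defines "L \<equiv> \<lambda>t. a * ln (1 - cos t) + b * ln (1 + cos t)"
  assumes ab: "0 \<le> a" "a \<le> b" and h: "0 < h" "h \<le> 1/2" "4 * (a + b) * h\<^sup>2 \<le> 1"
    and \<theta>: "0 < \<theta>" "\<theta> < pi"
  shows "\<exists>u v. 0 < u \<and> v < pi \<and> v - u = h \<and> \<theta> \<in> {u..v} \<and> (\<forall>t\<in>{u..v}. L \<theta> - 1 \<le> L t)"
proof -
  define D where "D t = ((a + b) * cos t - (b - a)) / sin t" for t
  have deriv: "(L has_real_derivative D t) (at t)" if "0 < t" "t < pi" for t
    unfolding L_def D_def using that by (rule log_jacobi_weight_deriv)
  \<comment> \<open>The zero of the numerator of \<open>D\<close>. For \<open>a = b = 0\<close> the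
    quotient is 0 by convention, so \<open>p = pi / 2\<close>, and \<open>cos_p\<close> still
    holds.\<close>
  define p where "p = arccos ((b - a) / (a + b))"
  have x0: "0 \<le> (b - a) / (a + b)" "(b - a) / (a + b) \<le> 1"
    using ab by (auto simp: divide_le_eq)
  have p: "0 \<le> p" "p \<le> pi / 2"
    unfolding p_def using x0 arccos_lbound[of "(b - a) / (a + b)"] arccos_le_pi2 by auto
  have "cos p = (b - a) / (a + b)"
    unfolding p_def using x0 by (intro cos_arccos) auto
  then have cos_p: "(a + b) * cos p = b - a"
    using ab by auto
  have D: "D t = (a + b) * (cos t - cos p) / sin t" for t
    by (simp add: D_def right_diff_distrib cos_p)
  have pi1: "1 \<le> pi / 3" using pi_gt3 by simp
  show ?thesis
  proof (cases "\<theta> \<le> p + h")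
    case True
    \<comment> \<open>The interval from \<open>\<theta>\<close> to \<open>\<theta> + h\<close> ends
      by \<open>p + 2 * h\<close>. At this rate of decrease \<open>L\<close> loses at most
      \<open>4 * (a + b) * h\<^sup>2 \<le> 1\<close> on it.\<close>
    have D_ge: "D t \<ge> - (4 * (a + b) * h)" if t: "0 < t" "t \<le> p + 2 * h" for t
    proof (cases "t \<le> p")
      case True
      then have "cos t \<ge> cos p"
        using p t by (intro cos_monotone_0_pi_le) auto
      moreover have "sin t > 0"
        using t True p pi1 by (intro sin_gt_zero) auto
      ultimately have "D t \<ge> 0"
        unfolding D using ab by simp
      moreover have "4 * (a + b) * h \<ge> 0"
        using ab h by simp
      ultimately show ?thesis by linarith
    next
      case False
      have s: "sin t > 0"
        using t p pi1 h by (intro sin_gt_zero) auto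
      \<comment> \<open>This lets the sine of the midpoint cancel the denominator of
        \<open>D\<close>. Up to \<open>pi / 2\<close> the sine is increasing; beyond,
        \<open>t - pi / 2 \<le> 2 * h \<le> 1 \<le> pi / 3\<close> gives
        \<open>sin t \<ge> 1/2\<close>.\<close>
      have s2: "sin ((p + t) / 2) \<le> 2 * sin t"
      proof (cases "t \<le> pi / 2")
        case True
        then have "sin ((p + t) / 2) \<le> sin t"
          using p False by (intro sin_monotone_2pi_le) auto
        then show ?thesis using s by simp
      next
        case False
        have "cos (pi / 3) \<le> cos (t - pi / 2)"
          using False t p h pi1 by (intro cos_monotone_0_pi_le) auto
        then have "sin t \<ge> 1 / 2"
          by (simp add: cos_60 cos_diff)
        then show ?thesis
          using sin_le_one[of "(p + t) / 2"] by linarith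
      qed
      have "cos p - cos t = 2 * sin ((p + t) / 2) * sin ((t - p) / 2)"
        by (rule cos_diff_cos)
      also have "\<dots> \<le> 2 * sin ((p + t) / 2) * h"
      proof -
        have "sin ((t - p) / 2) \<le> (t - p) / 2"
          using False by (intro sin_x_le_x) auto
        then have "sin ((t - p) / 2) \<le> h" using t by simp
        moreover have "sin ((p + t) / 2) \<ge> 0"
          using p t h pi1 by (intro sin_ge_zero) auto
        ultimately show ?thesis
          by (intro mult_left_mono) auto
      qed
      also have "\<dots> \<le> 4 * h * sin t"
        using mult_right_mono[OF s2, of "2 * h"] h by simp
      finally have "(a + b) * (cos p - cos t) \<le> (a + b) * (4 * h * sin t)"
        using ab by (intro mult_left_mono) auto
      then show ?thesis
        unfolding D using s by (simp add: field_simps)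
    qed
    have "L \<theta> - 1 \<le> L t" if t: "t \<in> {\<theta>..\<theta> + h}" for t
    proof (cases "t = \<theta>")
      case False
      then have "\<theta> < t" using t by simp
      have "t < pi" using t True p h pi1 by auto
      obtain z where z: "\<theta> < z" "z < t" "L t - L \<theta> = (t - \<theta>) * D z"
        using MVT2[OF \<open>\<theta> < t\<close>, of L D] deriv \<theta> \<open>t < pi\<close> by force
      have "(t - \<theta>) * D z \<ge> (t - \<theta>) * (- (4 * (a + b) * h))"
        using z \<theta> True t by (intro mult_left_mono D_ge) auto
      moreover have "(t - \<theta>) * (4 * (a + b) * h) \<le> h * (4 * (a + b) * h)"
        using t ab h by (intro mult_right_mono) auto
      ultimately show ?thesis
        using h(3) z(3) by (simp add: power2_eq_square algebra_simps)
    qed simp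
    then show ?thesis
      using True \<theta> p h pi1 by (intro exI[of _ \<theta>] exI[of _ "\<theta> + h"]) auto
  next
    case False
    \<comment> \<open>The whole interval lies to the right of \<open>p\<close>, where
      \<open>L\<close> decreases, so moving left loses nothing.\<close>
    have "L \<theta> \<le> L t" if t: "t \<in> {\<theta> - h..\<theta>}" for t
    proof (rule DERIV_nonpos_imp_nonincreasing[where f = L])
      show "t \<le> \<theta>" using t by simp
      show "\<exists>y. (L has_real_derivative y) (at x) \<and> y \<le> 0" if x: "t \<le> x" "x \<le> \<theta>" for x
      proof (intro exI conjI)
        have x': "p < x" "x < pi" using x t False \<theta> by auto
        then show "(L has_real_derivative D x) (at x)"
          using p by (intro deriv) auto
        have "cos x \<le> cos p" "sin x > 0"
          using x' p by (auto intro!: cos_monotone_0_pi_le sin_gt_zero)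
        then show "D x \<le> 0"
          unfolding D using ab by (intro divide_nonpos_pos mult_nonneg_nonpos) auto
      qed
    qed
    then show ?thesis
      using False \<theta> p h by (intro exI[of _ "\<theta> - h"] exI[of _ \<theta>]) force
  qed
qed

text \<open>Reflecting \<open>t\<close> to \<open>pi - t\<close> exchanges \<open>a\<close> and
  \<open>b\<close>, which reduces the case \<open>b < a\<close> to \<open>a \<le> b\<close>.\<close>

lemma log_jacobi_weight_interval:
  fixes a b h \<theta> :: real
  assumes ab: "0 \<le> a" "0 \<le> b" and h: "0 < h" "h \<le> 1/2" "4 * (a + b) * h\<^sup>2 \<le> 1"
    and \<theta>: "0 < \<theta>" "\<theta> < pi"
  shows "\<exists>u v. 0 < u \<and> v < pi \<and> v - u = h \<and> \<theta> \<in> {u..v} \<and>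
           (\<forall>t\<in>{u..v}. a * ln (1 - cos \<theta>) + b * ln (1 + cos \<theta>) - 1
                          \<le> a * ln (1 - cos t) + b * ln (1 + cos t))"
proof (cases "a \<le> b")
  case True
  then show ?thesis
    using log_jacobi_weight_interval_aux[of a b h \<theta>] assms by auto
next
  case False
  then obtain u v where uv: "0 < u" "v < pi" "v - u = h" "pi - \<theta> \<in> {u..v}"
    "\<And>t. t \<in> {u..v} \<Longrightarrow> b * ln (1 - cos (pi - \<theta>)) + a * ln (1 + cos (pi - \<theta>)) - 1
             \<le> b * ln (1 - cos t) + a * ln (1 + cos t)"
    using log_jacobi_weight_interval_aux[of b a h "pi - \<theta>"] assms by (auto simp: add.commute)
  have "a * ln (1 - cos \<theta>) + b * ln (1 + cos \<theta>) - 1 \<le> a * ln (1 - cos t) + b * ln (1 + cos t)"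
    if "t \<in> {pi - v..pi - u}" for t
    using uv(5)[of "pi - t"] that by simp
  then show ?thesis
    using uv(1-4) by (intro exI[of _ "pi - v"] exI[of _ "pi - u"]) auto
qed

text \<open>Under \<open>x = cos t\<close> the additive loss 1 in the logarithm becomes the factor
  \<open>exp 1\<close>. Since \<open>cos\<close> decreases, \<open>c\<close> and \<open>d\<close>
  are the cosines of the right and left ends.\<close>

lemma jacobi_weight_interval:
  fixes a b h x :: real
  assumes ab: "0 \<le> a" "0 \<le> b" and h: "0 < h" "h \<le> 1/2" "4 * (a + b) * h\<^sup>2 \<le> 1"
    and x: "-1 < x" "x < 1"
  shows "\<exists>c d. -1 < c \<and> d < 1 \<and> arccos c - arccos d = h \<and> x \<in> {c..d} \<and>
           (\<forall>y\<in>{c..d}. jacobi_weight a b x \<le> exp 1 * jacobi_weight a b y)"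
proof -
  let ?L = "\<lambda>t. a * ln (1 - cos t) + b * ln (1 + cos t)"
  have weight: "jacobi_weight a b y = exp (?L (arccos y))" if "-1 < y" "y < 1" for y
    using that by (simp add: jacobi_weight_def powr_def exp_add cos_arccos)
  obtain u v where uv: "0 < u" "v < pi" "v - u = h" "arccos x \<in> {u..v}"
    "\<And>t. t \<in> {u..v} \<Longrightarrow> ?L (arccos x) - 1 \<le> ?L t"
    using log_jacobi_weight_interval[OF ab h, of "arccos x"] arccos_lt_bounded[OF x] by blast
  have bounds: "-1 < cos v" "cos u < 1"
    using uv h cos_monotone_0_pi[of 0 u] cos_monotone_0_pi[of v pi] by auto
  have arccos: "arccos (cos u) = u" "arccos (cos v) = v"
    using uv h by (auto intro!: arccos_cos)
  have "cos (arccos x) \<le> cos u" "cos v \<le> cos (arccos x)"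
    using uv by (auto intro!: cos_monotone_0_pi_le)
  then have "x \<in> {cos v..cos u}"
    using x by (simp add: cos_arccos)
  moreover have "jacobi_weight a b x \<le> exp 1 * jacobi_weight a b y" if "y \<in> {cos v..cos u}" for y
  proof -
    have y: "-1 < y" "y < 1" using that bounds by auto
    have "arccos y \<le> arccos (cos v)" "arccos (cos u) \<le> arccos y"
      using that y bounds by (auto intro!: arccos_le_arccos)
    then have "?L (arccos x) \<le> 1 + ?L (arccos y)"
      using uv(5)[of "arccos y"] arccos by auto
    then show ?thesis
      unfolding weight[OF x] weight[OF y] exp_add[symmetric] by simp
  qed
  ultimately show ?thesis
    using bounds arccos uv(3) by (intro exI[of _ "cos v"] exI[of _ "cos u"]) auto
qed

section \<open>The weighted pointwise bound\<close>

lemma diff_le_integral_abs_deriv: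
  fixes f f' :: "real \<Rightarrow> real"
  assumes deriv: "\<And>t. t \<in> {c..d} \<Longrightarrow> (f has_real_derivative f' t) (at t)"
    and cont: "continuous_on {c..d} f'" and xy: "x \<in> {c..d}" "y \<in> {c..d}"
  shows "f x - f y \<le> integral {c..d} (\<lambda>t. \<bar>f' t\<bar>)"
proof -
  have *: "\<bar>f v - f u\<bar> \<le> integral {c..d} (\<lambda>t. \<bar>f' t\<bar>)" if uv: "u \<le> v" "c \<le> u" "v \<le> d" for u v
  proof -
    have cont': "continuous_on {u..v} f'"
      using cont by (rule continuous_on_subset) (use uv in auto)
    have "(f' has_integral (f v - f u)) {u..v}"
      using uv by (intro fundamental_theorem_of_calculus)
        (auto simp: has_real_derivative_iff_has_vector_derivative[symmetric]
          intro!: DERIV_subset[OF deriv])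
    then have "\<bar>f v - f u\<bar> = \<bar>integral {u..v} f'\<bar>"
      by (simp add: integral_unique)
    also have "\<dots> \<le> integral {u..v} (\<lambda>t. \<bar>f' t\<bar>)"
      using cont' integral_norm_bound_integral[of f' "{u..v}" "\<lambda>t. \<bar>f' t\<bar>"]
      by (simp add: integrable_continuous_real continuous_on_rabs)
    also have "\<dots> \<le> integral {c..d} (\<lambda>t. \<bar>f' t\<bar>)"
      using cont cont' uv
      by (intro integral_subset_le integrable_continuous_real continuous_intros) auto
    finally show ?thesis .
  qed
  show ?thesis
    using *[of x y] *[of y x] xy by (cases "x \<le> y") auto
qed

text \<open>The product is again a Jacobi weight, and its exponents are nonnegative for
  \<open>\<alpha>, \<beta> \<ge> -1/2\<close>, as \<open>jacobi_weight_interval\<close>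
  requires.\<close>

lemma jacobi_weight_sqrt:
  assumes "-1 < x" "x < 1"
  shows "jacobi_weight \<alpha> \<beta> x * sqrt (1 - x\<^sup>2) = jacobi_weight (\<alpha> + 1/2) (\<beta> + 1/2) x"
proof -
  have "1 - x\<^sup>2 = (1 - x) * (1 + x)"
    by (simp add: power2_eq_square algebra_simps)
  then have "sqrt (1 - x\<^sup>2) = (1 - x) powr (1/2) * (1 + x) powr (1/2)"
    using assms by (simp add: real_sqrt_mult powr_half_sqrt)
  then show ?thesis
    by (simp add: jacobi_weight_def powr_add)
qed

lemma continuous_on_jacobi_weight:
  assumes "-1 < c" "d < 1"
  shows "continuous_on {c..d} (jacobi_weight \<alpha> \<beta>)"
  unfolding jacobi_weight_def[abs_def] using assms by (intro continuous_intros) auto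

text \<open>
  With \<open>\<rho> = w \<surd>(1 - x\<^sup>2)\<close>, weighted integration of \<open>(Q\<^sup>2)'\<close> over an interval on which
  \<open>\<rho>(x) \<le> e \<rho>\<close> compares \<open>Q(x)\<^sup>2 \<rho>(x)\<close> with \<open>Q(y)\<^sup>2 \<rho>(y)\<close>; this is then averaged over \<open>y\<close> with
  respect to \<open>dy / \<surd>(1 - y\<^sup>2)\<close>.
\<close>
lemma jacobi_pointwise_bound:
  fixes Q :: "real poly" and \<alpha> \<beta> h M x :: real
  defines "w \<equiv> jacobi_weight \<alpha> \<beta>"
  defines "I \<equiv> integral {-1..1} (\<lambda>t. (poly Q t)\<^sup>2 * w t)"
  assumes \<alpha>: "\<alpha> \<ge> -1/2" and \<beta>: "\<beta> \<ge> -1/2"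
    and h: "0 < h" "h \<le> 1/2" "4 * (\<alpha> + \<beta> + 1) * h\<^sup>2 \<le> 1"
    and M: "0 < M" "real n * (real n + \<alpha> + \<beta> + 1) \<le> M\<^sup>2"
    and Q: "degree Q \<le> n" and x: "-1 < x" "x < 1"
  shows "(poly Q x)\<^sup>2 * w x * sqrt (1 - x\<^sup>2) \<le> exp 1 * (1 / h + 2 * M) * I"
proof -
  define \<rho> where "\<rho> = jacobi_weight (\<alpha> + 1/2) (\<beta> + 1/2)"
  have \<rho>: "w t * sqrt (1 - t\<^sup>2) = \<rho> t" if "-1 < t" "t < 1" for t
    unfolding w_def \<rho>_def using that by (rule jacobi_weight_sqrt)
  have w_nonneg: "w t \<ge> 0" for t
    by (simp add: w_def jacobi_weight_nonneg)
  obtain c d where cd: "-1 < c" "d < 1" "arccos c - arccos d = h" "x \<in> {c..d}"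
    and \<rho>_le: "\<And>y. y \<in> {c..d} \<Longrightarrow> \<rho> x \<le> exp 1 * \<rho> y"
    using jacobi_weight_interval[of "\<alpha> + 1/2" "\<beta> + 1/2" h x] \<alpha> \<beta> h x
    unfolding \<rho>_def by (auto simp: add_ac)
  have cont_w: "continuous_on {c..d} w"
    unfolding w_def using cd by (auto intro: continuous_on_jacobi_weight)
  define E where "E = integral {-1..1} (\<lambda>t. (poly (pderiv Q) t)\<^sup>2 * (1 - t\<^sup>2) * w t)"
  have int: "(\<lambda>t. (poly Q t)\<^sup>2 * w t) integrable_on {-1..1}"
       "(\<lambda>t. (poly (pderiv Q) t)\<^sup>2 * (1 - t\<^sup>2) * w t) integrable_on {-1..1}"
    unfolding w_def using \<alpha> \<beta>
    by (intro integrable_continuous_jacobi_weight continuous_intros; simp)+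
  have I_nonneg: "I \<ge> 0"
    unfolding I_def using int(1) by (rule integral_nonneg) (simp add: w_nonneg)
  have "E \<le> real n * (real n + \<alpha> + \<beta> + 1) * I"
    unfolding E_def I_def w_def using \<alpha> \<beta> Q by (intro jacobi_energy_bound) auto
  also have "\<dots> \<le> M\<^sup>2 * I"
    using M I_nonneg by (intro mult_right_mono) auto
  finally have E: "E / M \<le> M * I"
    using M(1) by (simp add: divide_le_eq power2_eq_square mult_ac)

  let ?R' = "\<lambda>t. 2 * poly Q t * poly (pderiv Q) t"
  \<comment> \<open>\<open>?G\<close> is the majorant of
    \<open>\<bar>(Q\<^sup>2)'\<bar> \<rho>\<close> from the arithmetic-geometric mean inequality.
    The balance \<open>M\<close> against \<open>1 / M\<close> makes the integral of each term at
    most \<open>M * I\<close>.\<close>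
  let ?G = "\<lambda>t. M * ((poly Q t)\<^sup>2 * w t) + 1 / M * ((poly (pderiv Q) t)\<^sup>2 * (1 - t\<^sup>2) * w t)"
  have intG: "?G integrable_on {-1..1}"
    using int by (intro integrable_add integrable_on_mult_right)
  have "integral {-1..1} ?G = M * I + E / M"
    unfolding I_def E_def using int
    by (subst integral_add) (auto intro: integrable_on_mult_right integrable_on_divide)
  also have "\<dots> \<le> 2 * M * I"
    using E by (simp add: mult_ac)
  finally have G: "integral {-1..1} ?G \<le> 2 * M * I" .
  have R'_le: "\<rho> x * \<bar>?R' t\<bar> \<le> exp 1 * ?G t" if t: "t \<in> {c..d}" for t
  proof -
    have t': "-1 < t" "t < 1" using t cd by auto
    then have "t\<^sup>2 < 1" by (simp add: abs_square_less_1 abs_less_iff)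
    define s where "s = sqrt (1 - t\<^sup>2)"
    have s: "s \<ge> 0" "s\<^sup>2 = 1 - t\<^sup>2" using \<open>t\<^sup>2 < 1\<close> by (auto simp: s_def)
    have "M * (\<bar>?R' t\<bar> * s) = 2 * (M * \<bar>poly Q t\<bar>) * (\<bar>poly (pderiv Q) t\<bar> * s)"
      by (simp add: abs_mult)
    also have "\<dots> \<le> (M * \<bar>poly Q t\<bar>)\<^sup>2 + (\<bar>poly (pderiv Q) t\<bar> * s)\<^sup>2"
      by (rule sum_squares_bound)
    also have "\<dots> = M * (M * (poly Q t)\<^sup>2 + 1 / M * ((poly (pderiv Q) t)\<^sup>2 * s\<^sup>2))"
      using M(1) by (simp add: power_mult_distrib distrib_left power2_eq_square[of M])
    finally have "M * (\<bar>?R' t\<bar> * s) \<le> M * (M * (poly Q t)\<^sup>2 + 1 / M * ((poly (pderiv Q) t)\<^sup>2 * s\<^sup>2))" .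
    with M(1) have "\<bar>?R' t\<bar> * s \<le> M * (poly Q t)\<^sup>2 + 1 / M * ((poly (pderiv Q) t)\<^sup>2 * s\<^sup>2)"
      by (simp only: mult_le_cancel_left_pos)
    then have "w t * (\<bar>?R' t\<bar> * s) \<le> w t * (M * (poly Q t)\<^sup>2 + 1 / M * ((poly (pderiv Q) t)\<^sup>2 * s\<^sup>2))"
      by (intro mult_left_mono w_nonneg)
    also have "w t * (\<bar>?R' t\<bar> * s) = \<rho> t * \<bar>?R' t\<bar>"
      using \<rho>[OF t'] by (simp add: s_def mult_ac)
    also have "w t * (M * (poly Q t)\<^sup>2 + 1 / M * ((poly (pderiv Q) t)\<^sup>2 * s\<^sup>2)) = ?G t"
      by (simp add: s algebra_simps)
    finally have "exp 1 * (\<rho> t * \<bar>?R' t\<bar>) \<le> exp 1 * ?G t"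
      by simp
    moreover have "\<rho> x * \<bar>?R' t\<bar> \<le> exp 1 * \<rho> t * \<bar>?R' t\<bar>"
      using \<rho>_le[OF t] by (rule mult_right_mono) simp
    ultimately show ?thesis
      by (simp only: mult.assoc)
  qed

  \<comment> \<open>\<open>K\<close> is what remains of \<open>\<rho>(x) Q(x)\<^sup>2\<close> after
    the largest possible weighted variation of \<open>Q\<^sup>2\<close> on \<open>{c..d}\<close> is
    subtracted.\<close>
  define K where "K = \<rho> x * (poly Q x)\<^sup>2 - exp 1 * (2 * M * I)"
  have \<rho>x: "\<rho> x \<ge> 0" by (simp add: \<rho>_def jacobi_weight_nonneg)
  have K_le: "K \<le> exp 1 * (\<rho> y * (poly Q y)\<^sup>2)" if y: "y \<in> {c..d}" for y
  proof -
    have "((\<lambda>t. (poly Q t)\<^sup>2) has_real_derivative ?R' t) (at t)" for t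
      using DERIV_power[OF poly_DERIV[of Q t], of 2] by (simp add: mult_ac)
    then have "(poly Q x)\<^sup>2 - (poly Q y)\<^sup>2 \<le> integral {c..d} (\<lambda>t. \<bar>?R' t\<bar>)"
      by (rule diff_le_integral_abs_deriv[OF _ _ cd(4) y]) (intro continuous_intros)
    then have "\<rho> x * ((poly Q x)\<^sup>2 - (poly Q y)\<^sup>2) \<le> integral {c..d} (\<lambda>t. \<rho> x * \<bar>?R' t\<bar>)"
      using \<rho>x by (simp add: mult_left_mono)
    also have "\<dots> \<le> integral {c..d} (\<lambda>t. exp 1 * ?G t)"
      by (intro integral_le integrable_continuous_real continuous_intros cont_w R'_le)
    also have "\<dots> \<le> integral {-1..1} (\<lambda>t. exp 1 * ?G t)"
    proof (rule integral_subset_le)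
      show "(\<lambda>t. exp 1 * ?G t) integrable_on {c..d}"
        by (intro integrable_continuous_real continuous_intros cont_w)
      show "(\<lambda>t. exp 1 * ?G t) integrable_on {-1..1}"
        using intG by (rule integrable_on_mult_right)
      show "\<forall>t\<in>{-1..1}. 0 \<le> exp 1 * ?G t"
      proof
        fix t :: real assume "t \<in> {-1..1}"
        then have "t\<^sup>2 \<le> 1" by (simp add: abs_square_le_1 abs_le_iff)
        then show "0 \<le> exp 1 * ?G t"
          using M(1) w_nonneg by (intro mult_nonneg_nonneg add_nonneg_nonneg) auto
      qed
    qed (use cd in auto)
    also have "\<dots> \<le> exp 1 * (2 * M * I)"
      using G by simp
    finally have "K \<le> \<rho> x * (poly Q y)\<^sup>2"
      by (simp add: K_def algebra_simps)
    also have "\<dots> \<le> exp 1 * \<rho> y * (poly Q y)\<^sup>2"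
      by (intro mult_right_mono \<rho>_le y) auto
    finally show ?thesis by simp
  qed

  \<comment> \<open>The measure \<open>dy / \<surd>(1 - y\<^sup>2)\<close> is arc length in the
    angle, so \<open>{c..d}\<close> has mass \<open>h\<close>.\<close>
  have "((\<lambda>y. K * inverse (sqrt (1 - y\<^sup>2))) has_integral (- K * arccos d - (- K * arccos c))) {c..d}"
  proof (rule fundamental_theorem_of_calculus)
    fix y assume y: "y \<in> {c..d}"
    have "(arccos has_real_derivative inverse (- sqrt (1 - y\<^sup>2))) (at y)"
      using y cd by (intro DERIV_arccos) auto
    then have "((\<lambda>y. - K * arccos y) has_real_derivative - K * inverse (- sqrt (1 - y\<^sup>2))) (at y within {c..d})"
      by (intro DERIV_cmult DERIV_subset[where t = "{c..d}" and s = UNIV]) auto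
    then show "((\<lambda>y. - K * arccos y) has_vector_derivative K * inverse (sqrt (1 - y\<^sup>2))) (at y within {c..d})"
      by (simp add: has_real_derivative_iff_has_vector_derivative)
  qed (use cd in auto)
  moreover have "- K * arccos d - (- K * arccos c) = K * h"
    using cd(3) by (simp add: algebra_simps flip: cd(3))
  ultimately have Kh: "((\<lambda>y. K * inverse (sqrt (1 - y\<^sup>2))) has_integral (K * h)) {c..d}"
    by simp
  have intcd: "(\<lambda>t. (poly Q t)\<^sup>2 * w t) integrable_on {c..d}"
    by (intro integrable_continuous_real continuous_intros cont_w)
  \<comment> \<open>Dividing \<open>\<rho>\<close> by \<open>\<surd>(1 - y\<^sup>2)\<close> restores
    \<open>w\<close>, so the average of the bound on \<open>K\<close> is controlled by
    \<open>I\<close>.\<close>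
  have "K * h \<le> integral {c..d} (\<lambda>y. exp 1 * ((poly Q y)\<^sup>2 * w y))"
  proof (rule has_integral_le[OF Kh])
    show "((\<lambda>y. exp 1 * ((poly Q y)\<^sup>2 * w y)) has_integral
            integral {c..d} (\<lambda>y. exp 1 * ((poly Q y)\<^sup>2 * w y))) {c..d}"
      by (intro integrable_integral integrable_on_mult_right intcd)
    fix y assume y: "y \<in> {c..d}"
    have y': "-1 < y" "y < 1" using y cd by auto
    then have "y\<^sup>2 < 1" by (simp add: abs_square_less_1 abs_less_iff)
    then have "sqrt (1 - y\<^sup>2) > 0" by simp
    then show "K * inverse (sqrt (1 - y\<^sup>2)) \<le> exp 1 * ((poly Q y)\<^sup>2 * w y)"
      using K_le[OF y] unfolding \<rho>[OF y', symmetric] by (simp add: field_simps)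
  qed
  also have "\<dots> = exp 1 * integral {c..d} (\<lambda>y. (poly Q y)\<^sup>2 * w y)"
    by simp
  also have "\<dots> \<le> exp 1 * I"
    unfolding I_def
    using cd by (intro mult_left_mono integral_subset_le int intcd) (auto simp: w_nonneg)
  finally have "K \<le> exp 1 * I / h"
    using h(1) by (simp add: pos_le_divide_eq)
  then have "\<rho> x * (poly Q x)\<^sup>2 \<le> exp 1 * (1 / h + 2 * M) * I"
    by (simp add: K_def algebra_simps)
  then show ?thesis
    unfolding mult.assoc[of "(poly Q x)\<^sup>2"] \<rho>[OF x] by (simp only: mult.commute)
qed

section \<open>Choice of constants\<close>

text \<open>These are the quantities that make up \<open>1 / h\<close> and \<open>M\<close> below.
  The bounds with \<open>S\<close> come from
  \<open>(n + 1) powr (1/2) \<le> (n + 1) powr (5/6)\<close>, where \<open>5/6 = 1 - 1/6\<close>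
  matches the exponent in \<open>Phi\<close>.\<close>

lemma Phi_bounds:
  assumes "S \<ge> 0"
  shows "1 \<le> real (n + 1) * Phi n S" "real n \<le> real (n + 1) * Phi n S"
    and "sqrt S \<le> real (n + 1) * Phi n S" "sqrt (real n * S) \<le> real (n + 1) * Phi n S"
proof -
  let ?N = "real (n + 1)"
  have N: "?N \<ge> 1" by simp
  have Phi: "1 \<le> Phi n S" "S powr (1/2) * ?N powr (-1/6) \<le> Phi n S"
    by (simp_all add: Phi_def)
  have N_le: "?N \<le> ?N * Phi n S"
    using mult_left_mono[OF Phi(1), of ?N] by simp
  show "1 \<le> ?N * Phi n S" "real n \<le> ?N * Phi n S"
    by (rule order_trans[OF _ N_le], simp)+
  have "?N powr (1/2) \<le> ?N powr (5/6)"
    using N by (intro powr_mono) auto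
  also have "\<dots> = ?N powr (1 + (-1/6))"
    by simp
  also have "\<dots> = ?N * ?N powr (-1/6)"
    by (subst powr_add) simp
  finally have "sqrt ?N * sqrt S \<le> ?N * ?N powr (-1/6) * sqrt S"
    using assms by (intro mult_right_mono) (auto simp: powr_half_sqrt)
  also have "\<dots> = ?N * (S powr (1/2) * ?N powr (-1/6))"
    using assms by (simp add: powr_half_sqrt)
  also have "\<dots> \<le> ?N * Phi n S"
    by (intro mult_left_mono Phi) auto
  finally have *: "sqrt (?N * S) \<le> ?N * Phi n S"
    by (simp add: real_sqrt_mult)
  have "S \<le> ?N * S" "real n * S \<le> ?N * S"
    using assms by (auto simp: algebra_simps)
  then show "sqrt S \<le> ?N * Phi n S" "sqrt (real n * S) \<le> ?N * Phi n S"
    using * by (meson order_trans real_sqrt_le_mono)+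
qed

lemma jacobi_nikolskii:
  assumes \<alpha>: "\<alpha> \<ge> -1/2" and \<beta>: "\<beta> \<ge> -1/2" and Q: "degree Q \<le> n" and x: "-1 < x" "x < 1"
  shows "(poly Q x)\<^sup>2 * jacobi_weight \<alpha> \<beta> x * sqrt (1 - x\<^sup>2)
           \<le> 3 * C_star\<^sup>2 * real (n + 1) * Phi n (\<alpha> + \<beta> + 1)
             * integral {-1..1} (\<lambda>t. (poly Q t)\<^sup>2 * jacobi_weight \<alpha> \<beta> t)"
proof -
  let ?I = "integral {-1..1} (\<lambda>t. (poly Q t)\<^sup>2 * jacobi_weight \<alpha> \<beta> t)"
  define S where "S = \<alpha> + \<beta> + 1"
  define B where "B = real (n + 1) * Phi n S"
  have S: "S \<ge> 0" using \<alpha> \<beta> by (simp add: S_def)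
  note B = Phi_bounds[OF S, of n, folded B_def]
  \<comment> \<open>Then \<open>4 * S * h\<^sup>2 = S / (S + 1)\<close>, and
    \<open>S + 1 \<ge> 1\<close> keeps \<open>h\<close> at most \<open>1/2\<close>.\<close>
  define h where "h = 1 / (2 * sqrt (S + 1))"
  have h: "0 < h" "h \<le> 1/2" "4 * S * h\<^sup>2 \<le> 1"
    using S by (auto simp: h_def power_divide power_mult_distrib divide_le_eq)
  \<comment> \<open>The squares of the first two terms add up to \<open>n * (n + S)\<close>; the
    summand 1 keeps \<open>M\<close> positive when \<open>n = 0\<close>.\<close>
  define M where "M = real n + sqrt (real n * S) + 1"
  have M: "0 < M"
    using S by (simp add: M_def add_nonneg_pos)
  have "(real n)\<^sup>2 + (sqrt (real n * S))\<^sup>2 \<le> (real n + sqrt (real n * S))\<^sup>2"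
    using S by (simp add: power2_sum)
  also have "\<dots> \<le> M\<^sup>2"
    unfolding M_def using S by (intro power_mono) auto
  finally have M2: "real n * (real n + \<alpha> + \<beta> + 1) \<le> M\<^sup>2"
    using S by (simp add: S_def power2_eq_square algebra_simps)
  have "sqrt (S + 1) \<le> sqrt S + 1"
    using sqrt_add_le_add_sqrt[OF S, of 1] by simp
  then have "1 / h + 2 * M \<le> 2 * (sqrt S + 1) + 2 * M"
    by (simp add: h_def)
  \<comment> \<open>Five terms, each at most \<open>2 * B\<close>: those of \<open>sqrt S\<close>,
    \<open>n\<close>, \<open>sqrt (n * S)\<close> and two constants 2.\<close>
  also have "\<dots> \<le> 10 * B"
    unfolding M_def distrib_left using B by auto
  finally have "exp 1 * (1 / h + 2 * M) \<le> 3 * (10 * B)"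
    using exp_le h M by (intro mult_mono) auto
  also have "\<dots> \<le> 3 * C_star\<^sup>2 * B"
    using B(1) by (simp add: C_star_def power2_eq_square)
  finally have const: "exp 1 * (1 / h + 2 * M) \<le> 3 * C_star\<^sup>2 * B" .
  have "?I \<ge> 0"
    using \<alpha> \<beta>
    by (intro integral_nonneg integrable_continuous_jacobi_weight continuous_intros)
       (auto simp: jacobi_weight_nonneg)
  then have "exp 1 * (1 / h + 2 * M) * ?I \<le> 3 * C_star\<^sup>2 * B * ?I"
    by (intro mult_right_mono const)
  moreover have "(poly Q x)\<^sup>2 * jacobi_weight \<alpha> \<beta> x * sqrt (1 - x\<^sup>2)
      \<le> exp 1 * (1 / h + 2 * M) * ?I"
    using \<alpha> \<beta> h M M2 Q x unfolding S_def by (intro jacobi_pointwise_bound) auto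
  ultimately show ?thesis
    by (simp add: B_def S_def mult_ac)
qed

section \<open>Quadrature weights and the conclusion\<close>

text \<open>The square of the Lagrange polynomial of the node has degree at most
  \<open>2 * n\<close>, within the range of exactness, and vanishes at all other nodes, so the
  quadrature sum reduces to \<open>W x\<close>.\<close>

lemma gauss_jacobi_weight_eq:
  assumes "gauss_jacobi_rule \<alpha> \<beta> (n + 1) X W" "x \<in> X"
  obtains Q where "degree Q \<le> n" "poly Q x = 1"
    "W x = integral {-1..1} (\<lambda>t. (poly Q t)\<^sup>2 * jacobi_weight \<alpha> \<beta> t)"
proof
  have X: "finite X" "card X = n + 1"
    and exact: "\<And>Q. degree Q < 2 * (n + 1) \<Longrightarrow>
      integral {-1..1} (\<lambda>t. poly Q t * jacobi_weight \<alpha> \<beta> t) = (\<Sum>x\<in>X. W x * poly Q x)"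
    using assms(1) by (auto simp: gauss_jacobi_rule_def)
  define Q where "Q = (\<Prod>y\<in>X - {x}. smult (1 / (x - y)) [:-y, 1:])"
  have "degree Q \<le> sum (degree \<circ> (\<lambda>y. smult (1 / (x - y)) [:-y, 1:])) (X - {x})"
    unfolding Q_def using X by (intro degree_prod_sum_le) auto
  also have "\<dots> \<le> (\<Sum>y\<in>X - {x}. 1)"
    by (intro sum_mono) auto
  also have "\<dots> = n"
    using X assms(2) by simp
  finally show Q: "degree Q \<le> n" .
  show Qx: "poly Q x = 1"
    unfolding Q_def poly_prod by (intro prod.neutral) (auto simp: diff_divide_distrib[symmetric])
  have Qy: "poly Q y = 0" if "y \<in> X - {x}" for y
    unfolding Q_def poly_prod using that X by (intro prod_zero) auto
  have "degree (Q * Q) < 2 * (n + 1)"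
    using degree_mult_le[of Q Q] Q by simp
  from exact[OF this]
  have "integral {-1..1} (\<lambda>t. (poly Q t)\<^sup>2 * jacobi_weight \<alpha> \<beta> t) = (\<Sum>y\<in>X. W y * (poly Q y)\<^sup>2)"
    by (simp add: power2_eq_square)
  also have "\<dots> = W x * (poly Q x)\<^sup>2 + (\<Sum>y\<in>X - {x}. W y * (poly Q y)\<^sup>2)"
    using X assms(2) by (intro sum.remove)
  also have "(\<Sum>y\<in>X - {x}. W y * (poly Q y)\<^sup>2) = 0"
    using Qy by (intro sum.neutral) auto
  finally show "W x = integral {-1..1} (\<lambda>t. (poly Q t)\<^sup>2 * jacobi_weight \<alpha> \<beta> t)"
    using Qx by simp
qed

theorem theorem1p4:
  fixes n :: nat and \<alpha> \<beta> :: real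
  assumes "\<alpha> \<ge> -1/2" and "\<beta> \<ge> -1/2"
  shows "(\<forall>x\<in>{-1<..<1}.
            christoffel \<alpha> \<beta> n x \<ge>
              jacobi_weight \<alpha> \<beta> x * sqrt (1 - x\<^sup>2) /
                (3 * C_star\<^sup>2 * real (n + 1) * Phi n (\<alpha> + \<beta> + 1))) \<and>
         (\<forall>p X W. orthonormal_jacobi \<alpha> \<beta> p \<longrightarrow>
            X = {x. poly (p (n + 1)) x = 0} \<longrightarrow>
            gauss_jacobi_rule \<alpha> \<beta> (n + 1) X W \<longrightarrow>
            (\<forall>x\<in>X. W x \<ge>
              jacobi_weight \<alpha> \<beta> x * sqrt (1 - x\<^sup>2) /
                (3 * C_star\<^sup>2 * real (n + 1) * Phi n (\<alpha> + \<beta> + 1))))"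
proof -
  let ?B = "3 * C_star\<^sup>2 * real (n + 1) * Phi n (\<alpha> + \<beta> + 1)"
  have "1 \<le> real (n + 1) * Phi n (\<alpha> + \<beta> + 1)"
    using assms by (intro Phi_bounds) auto
  then have "real (n + 1) * Phi n (\<alpha> + \<beta> + 1) > 0"
    by (rule less_le_trans[OF zero_less_one])
  then have "3 * C_star\<^sup>2 * (real (n + 1) * Phi n (\<alpha> + \<beta> + 1)) > 0"
    by (intro mult_pos_pos[of "3 * C_star\<^sup>2"]) (simp add: C_star_def)
  then have B: "?B > 0"
    by (simp only: mult.assoc)
  \<comment> \<open>Setting \<open>Q(x) = 1\<close> in the pointwise bound treats all competitors
    for the Christoffel function at once; the Lagrange polynomial of a node is one of them.\<close>
  have bound: "jacobi_weight \<alpha> \<beta> x * sqrt (1 - x\<^sup>2) / ?B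
      \<le> integral {-1..1} (\<lambda>t. (poly Q t)\<^sup>2 * jacobi_weight \<alpha> \<beta> t)"
    if "-1 < x" "x < 1" "degree Q \<le> n" "poly Q x = 1" for Q x
    using jacobi_nikolskii[OF assms that(3,1,2)] that(4) B
    by (simp add: pos_divide_le_eq mult_ac)
  have "christoffel \<alpha> \<beta> n x \<ge> jacobi_weight \<alpha> \<beta> x * sqrt (1 - x\<^sup>2) / ?B"
    if "-1 < x" "x < 1" for x
    unfolding christoffel_def
  proof (rule cINF_greatest)
    have "1 \<in> {Q. degree Q \<le> n \<and> poly Q x = (1::real)}" by simp
    then show "{Q. degree Q \<le> n \<and> poly Q x = (1::real)} \<noteq> {}" by blast
  qed (use bound that in simp)
  moreover have "W x \<ge> jacobi_weight \<alpha> \<beta> x * sqrt (1 - x\<^sup>2) / ?B"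
    if rule: "gauss_jacobi_rule \<alpha> \<beta> (n + 1) X W" and x: "x \<in> X" for X W x
  proof -
    obtain Q where Q: "degree Q \<le> n" "poly Q x = 1"
      and W: "W x = integral {-1..1} (\<lambda>t. (poly Q t)\<^sup>2 * jacobi_weight \<alpha> \<beta> t)"
      using gauss_jacobi_weight_eq[OF rule x] by blast
    show ?thesis
    proof (cases "-1 < x \<and> x < 1")
      case True
      then show ?thesis
        using bound Q W by simp
    next
      case False
      \<comment> \<open>\<open>sqrt\<close> is nonpositive on nonpositive arguments, so no location of the nodes is needed.\<close>
      then have "\<not> x\<^sup>2 < 1"
        by (auto simp: abs_square_less_1 abs_less_iff)
      then have "sqrt (1 - x\<^sup>2) \<le> 0"
        by simp
      then have "jacobi_weight \<alpha> \<beta> x * sqrt (1 - x\<^sup>2) / ?B \<le> 0"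
        using B by (intro divide_nonpos_pos mult_nonneg_nonpos jacobi_weight_nonneg)
      also have "0 \<le> W x"
        unfolding W using assms
        by (intro integral_nonneg integrable_continuous_jacobi_weight continuous_intros)
           (auto simp: jacobi_weight_nonneg)
      finally show ?thesis .
    qed
  qed
  ultimately show ?thesis
    by simp
qed

end
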